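(* Let $k\ge1$. The $k$-conjugation $\omega_k$ is an involution on partitions bounded by $k$: for every partition $\lambda$ with $\lambda_1\le k$, $$\left(\lambda^{\omega_k}\right)^{\omega_k}=\lambda.$$
   Context: Diagrams are drawn with rows numbered from bottom to top (row $i$ of a partition $\lambda$ has $\lambda_i$ cells), and a skew diagram $\mu/\lambda$ is the diagram of $\mu$ with the cells of $\lambda$ deleted. The hook-length of a cell of a skew diagram $D$ is $1$ plus the number of cells of $D$ to its east plus the number of cells of $D$ to its north; $D$ has hook-lengths bounded by $k$ if no cell has hook-length larger than $k$. For a positive integer $m\le k$ and a skew diagram $D$, the $k$-multiplication $m\times^{(k)}D$ is the skew diagram $\overline D$ obtained by adding to $D$ a first column of length $m$ (a new column of $m$ consecutive cells immediately to the left of the first column of $D$) such that the number of parts (rows) of $\overline D$ is as small as possible while ensuring that the hook-lengths of $\overline D$ are bounded by $k$ (if $D$ is empty, the result is a single column of $m$ cells). For a $k$-bounded partition $\lambda=(\lambda_1,\dots,\lambda_n)$, let $D=\lambda_1\times^{(k)}\cdots\times^{(k)}\lambda_n$ be obtained by $k$-multiplying the entries of $\lambda$ from right to left ($\lambda_n$ denoting initially a single column of length $\lambda_n$). The $k$-conjugate $\lambda^{\omega_k}$ is the vector whose entries are the numbers of cells in the rows of $D$, read from bottom to top. It is known that $\lambda^{\omega_k}$ is again a $k$-bounded partition. *)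

theory Defs
  imports Main
begin

(* Partitions are weakly decreasing lists of positive integers; [] is the empty partition. *)

definition partition_list :: "nat list \<Rightarrow> bool" where
  "partition_list p \<longleftrightarrow> sorted_wrt (\<ge>) p \<and> (\<forall>x \<in> set p. 0 < x)"

definition bounded_partition :: "nat \<Rightarrow> nat list \<Rightarrow> bool" where
  "bounded_partition k p \<longleftrightarrow> partition_list p \<and> (\<forall>x \<in> set p. x \<le> k)"

(* A cell is a pair (row, column), both counted from 0; rows go from bottom to top and
   columns from left to right. *)

definition young_diagram :: "nat list \<Rightarrow> (nat \<times> nat) set" where
  "young_diagram p = {(i, j). i < length p \<and> j < p ! i}"

definition skew_diagram :: "(nat \<times> nat) set \<Rightarrow> bool" where
  "skew_diagram D \<longleftrightarrow>
     (\<exists>p q. partition_list p \<and> partition_list q \<and>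
            young_diagram q \<subseteq> young_diagram p \<and> D = young_diagram p - young_diagram q)"

definition hook_length :: "(nat \<times> nat) set \<Rightarrow> nat \<times> nat \<Rightarrow> nat" where
  "hook_length D c =
     1 + card {j. snd c < j \<and> (fst c, j) \<in> D} + card {i. fst c < i \<and> (i, snd c) \<in> D}"

definition hooks_bounded :: "nat \<Rightarrow> (nat \<times> nat) set \<Rightarrow> bool" where
  "hooks_bounded k D \<longleftrightarrow> (\<forall>c \<in> D. hook_length D c \<le> k)"

(* The height of the diagram. An empty row below the topmost cell counts as a row (a part of
   size zero): otherwise a column placed directly above all the rows of D would tie with one
   placed higher, with a gap. *)

definition num_rows :: "(nat \<times> nat) set \<Rightarrow> nat" where
  "num_rows D = (LEAST n. \<forall>c \<in> D. fst c < n)"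

definition row_size :: "(nat \<times> nat) set \<Rightarrow> nat \<Rightarrow> nat" where
  "row_size D i = card {j. (i, j) \<in> D}"

(* The column occupies the m rows a, ..., a + m - 1. Diagrams start in column 0, so the new
   column becomes column 0 and D is shifted by one column. *)

definition add_column :: "nat \<Rightarrow> nat \<Rightarrow> (nat \<times> nat) set \<Rightarrow> (nat \<times> nat) set" where
  "add_column a m D = {(i, 0) | i. a \<le> i \<and> i < a + m} \<union> {(i, Suc j) | i j. (i, j) \<in> D}"

(* For 1 <= m <= k and D built by k-multiplication the minimiser is unique. *)

definition k_mult :: "nat \<Rightarrow> nat \<Rightarrow> (nat \<times> nat) set \<Rightarrow> (nat \<times> nat) set" where
  "k_mult k m D =
     arg_min num_rows
       (\<lambda>E. (\<exists>a. E = add_column a m D) \<and> skew_diagram E \<and> hooks_bounded k E)"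

(* The product starts from the empty diagram; k-multiplying the empty diagram by m <= k gives
   a single column of m cells in the bottom rows. *)

definition k_diagram :: "nat \<Rightarrow> nat list \<Rightarrow> (nat \<times> nat) set" where
  "k_diagram k p = foldr (k_mult k) p {}"

definition k_conjugate :: "nat \<Rightarrow> nat list \<Rightarrow> nat list" where
  "k_conjugate k p = map (row_size (k_diagram k p)) [0..<num_rows (k_diagram k p)]"

end

theory Submission
  imports Defs
begin

text \<open>
  The product diagram of a bounded partition is determined by a property that does not
  distinguish rows from columns, and from this the involution is immediate.

  Call a cell outside a skew diagram \<open>D\<close>, but weakly south-west of some cell of \<open>D\<close>, a cell below
  \<open>D\<close>.  The property (predicate \<open>k_skew_shape\<close>) is that \<open>D\<close> is a finite skew diagram, that its
  hook-lengths are at most \<open>k\<close>, and that for each cell below \<open>D\<close>, in row \<open>i\<close> and column \<open>j\<close>, the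
  sizes of row \<open>i\<close> and of column \<open>j\<close> of \<open>D\<close> sum to more than \<open>k\<close>.  (These are the diagrams formed
  by the cells with hook-length at most \<open>k\<close> of a \<open>k + 1\<close>-core.)

  A diagram with this property is rebuilt by \<open>k\<close>-multiplication from its column sizes
  (lemma \<open>k_diagram_column_sizes\<close>).  Indeed, delete its first column, which has \<open>c\<close> cells and
  starts in row \<open>a\<close>.  Starting the column in a row \<open>i < a\<close> instead would produce a bottom hook
  of length \<open>c\<close> plus the size of row \<open>i\<close>, and \<open>(i, 0)\<close> is a cell below \<open>D\<close>, so this exceeds \<open>k\<close>.
  Hence \<open>a\<close> is the lowest admissible position.

  Conversely, each \<open>k\<close>-bounded partition is the list of column sizes of such a diagram
  (lemma \<open>ex_k_skew_shape\<close>): a column of length \<open>m\<close> is attached at the lowest row that has at most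
  \<open>k - m\<close> cells, and the property persists because the row and column sizes of such a diagram
  decrease weakly.

  So if \<open>D\<close> is the diagram of \<open>p\<close>, the conjugate of \<open>p\<close> lists the row sizes of \<open>D\<close>, that is, the
  column sizes of the transpose of \<open>D\<close>.  The transpose has the property as well, hence it is the
  diagram of the conjugate, and its row sizes are the column sizes of \<open>D\<close>, that is, \<open>p\<close>.
  The transpose of \<open>D\<close> is written as the converse relation \<open>D\<inverse>\<close> throughout, and facts on columns
  are facts on the rows of \<open>D\<inverse>\<close>.
\<close>

section \<open>Rows of finite diagrams and skewness\<close>

definition row_sizes :: "(nat \<times> nat) set \<Rightarrow> nat list" where
  "row_sizes D = map (row_size D) [0..<num_rows D]"

lemma k_conjugate_eq_row_sizes: "k_conjugate k p = row_sizes (k_diagram k p)"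
  by (simp add: k_conjugate_def row_sizes_def)

lemma finite_row: "finite D \<Longrightarrow> finite {j. (i, j) \<in> D}"
  by (rule finite_subset[OF _ finite_imageI[of D snd]]) force+

lemma finite_column: "finite D \<Longrightarrow> finite {i. (i, j) \<in> D}"
  by (rule finite_subset[OF _ finite_imageI[of D fst]]) force+

lemma less_num_rows_iff:
  assumes "finite D"
  shows "i < num_rows D \<longleftrightarrow> (\<exists>i' j. (i', j) \<in> D \<and> i \<le> i')"
proof -
  let ?P = "\<lambda>n. \<forall>c \<in> D. fst c < n"
  have "finite (fst ` D)" using assms by simp
  then have "\<exists>n. ?P n" unfolding finite_nat_set_iff_bounded by auto
  then have least: "?P (num_rows D)" unfolding num_rows_def by (rule LeastI_ex)
  have "i < num_rows D \<Longrightarrow> \<not> ?P i" unfolding num_rows_def by (rule not_less_Least)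
  then show ?thesis using least by fastforce
qed

lemma row_size_converse: "row_size (D\<inverse>) j = card {i. (i, j) \<in> D}"
  by (simp add: row_size_def)

definition order_convex :: "(nat \<times> nat) set \<Rightarrow> bool" where
  "order_convex D \<longleftrightarrow> (\<forall>i j i' j' x y. (i, j) \<in> D \<longrightarrow> (i', j') \<in> D \<longrightarrow>
     i \<le> x \<longrightarrow> x \<le> i' \<longrightarrow> j \<le> y \<longrightarrow> y \<le> j' \<longrightarrow> (x, y) \<in> D)"

lemma order_convexD:
  assumes "order_convex D" "(i, j) \<in> D" "(i', j') \<in> D" "i \<le> x" "x \<le> i'" "j \<le> y" "y \<le> j'"
  shows "(x, y) \<in> D"
  using assms(1)[unfolded order_convex_def, rule_format, OF assms(2-7)] .

text \<open>
  Finite order ideals of the quadrant are Young diagrams, and their rows are initial segments,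
  so the partition is read off from the row sizes.
\<close>

lemma order_ideal_young_diagram:
  assumes fin: "finite S"
    and down: "\<And>i j x y. (i, j) \<in> S \<Longrightarrow> x \<le> i \<Longrightarrow> y \<le> j \<Longrightarrow> (x, y) \<in> S"
  shows "\<exists>p. partition_list p \<and> young_diagram p = S"
proof (intro exI conjI)
  have row: "j < row_size S i \<longleftrightarrow> (i, j) \<in> S" for i j
  proof
    assume "j < row_size S i"
    then have "\<not> {y. (i, y) \<in> S} \<subseteq> {..<j}"
      using card_mono[of "{..<j}" "{y. (i, y) \<in> S}"] by (auto simp: row_size_def)
    then obtain y where "(i, y) \<in> S" "j \<le> y" by fastforce
    then show "(i, j) \<in> S" using down by blast
  next
    assume "(i, j) \<in> S"
    then have "{..j} \<subseteq> {y. (i, y) \<in> S}" using down by blast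
    then show "j < row_size S i"
      using card_mono[OF finite_row[OF fin, of i], of "{..j}"] by (simp add: row_size_def)
  qed
  have decr: "row_size S i' \<le> row_size S i" if "i \<le> i'" for i i'
    unfolding row_size_def using that down by (intro card_mono finite_row[OF fin]) blast
  have pos: "0 < row_size S i" if "i < num_rows S" for i
    using that down row unfolding less_num_rows_iff[OF fin] by blast
  show "partition_list (row_sizes S)"
    unfolding partition_list_def row_sizes_def
    by (auto simp: sorted_wrt_iff_nth_less decr pos)
  show "young_diagram (row_sizes S) = S"
  proof -
    have "i < num_rows S" if "(i, j) \<in> S" for i j
      using that less_num_rows_iff[OF fin] by blast
    then show ?thesis by (auto simp: young_diagram_def row_sizes_def row)
  qed
qed

text \<open>
  The outer shape is the order ideal generated by \<open>D\<close>; by convexity the cells below \<open>D\<close> form an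
  order ideal too, which is the inner shape.
\<close>

lemma order_convex_skew_diagram:
  assumes fin: "finite D" and conv: "order_convex D"
  shows "skew_diagram D"
proof -
  let ?S = "{(x, y). \<exists>i j. (i, j) \<in> D \<and> x \<le> i \<and> y \<le> j}"
  have "?S = (\<Union>(i, j)\<in>D. {..i} \<times> {..j})" by auto
  then have finS: "finite ?S" using fin by auto
  have "(x, y) \<in> ?S" if "(i, j) \<in> ?S" "x \<le> i" "y \<le> j" for i j x y
  proof -
    from that(1) obtain i' j' where "(i', j') \<in> D" "i \<le> i'" "j \<le> j'" by auto
    then have "(i', j') \<in> D \<and> x \<le> i' \<and> y \<le> j'" using that by simp
    then show ?thesis by blast
  qed
  then obtain p where p: "partition_list p" "young_diagram p = ?S"
    using order_ideal_young_diagram[OF finS] by blast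
  have "(x, y) \<in> ?S - D" if ij: "(i, j) \<in> ?S - D" and le: "x \<le> i" "y \<le> j" for i j x y
  proof -
    from ij obtain i' j' where "(i', j') \<in> D" "i \<le> i'" "j \<le> j'" "(i, j) \<notin> D" by auto
    moreover from this have "(i', j') \<in> D \<and> x \<le> i' \<and> y \<le> j'" using le by simp
    then have "(x, y) \<in> ?S" by blast
    ultimately show ?thesis
      using le order_convexD[OF conv, of x y i' j' i j] by blast
  qed
  then obtain q where q: "partition_list q" "young_diagram q = ?S - D"
    using order_ideal_young_diagram[of "?S - D"] finS by blast
  have "D \<subseteq> ?S" by auto
  then have "D = young_diagram p - young_diagram q" using p q by auto
  moreover have "young_diagram q \<subseteq> young_diagram p" unfolding p q by (rule Diff_subset)
  ultimately show ?thesis unfolding skew_diagram_def using p(1) q(1) by (intro exI conjI)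
qed

section \<open>A transposition-invariant class of diagrams\<close>

definition k_skew_shape :: "nat \<Rightarrow> (nat \<times> nat) set \<Rightarrow> bool" where
  "k_skew_shape k D \<longleftrightarrow> finite D \<and> order_convex D \<and> hooks_bounded k D \<and>
     (\<forall>i j i' j'. (i, j) \<notin> D \<longrightarrow> (i', j') \<in> D \<longrightarrow> i \<le> i' \<longrightarrow> j \<le> j' \<longrightarrow>
        k < row_size D i + row_size (D\<inverse>) j)"

lemma k_skew_shapeD:
  assumes "k_skew_shape k D"
  shows "finite D" "order_convex D" "hooks_bounded k D"
  using assms by (auto simp: k_skew_shape_def)

lemma k_skew_shape_below:
  assumes "k_skew_shape k D" "(i, j) \<notin> D" "(i', j') \<in> D" "i \<le> i'" "j \<le> j'"
  shows "k < row_size D i + row_size (D\<inverse>) j"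
  using assms(1)[unfolded k_skew_shape_def, THEN conjunct2, THEN conjunct2, THEN conjunct2,
      rule_format, OF assms(2-5)] .

lemma k_skew_shape_converse:
  assumes "k_skew_shape k D"
  shows "k_skew_shape k (D\<inverse>)"
proof -
  have "order_convex (D\<inverse>)"
    using k_skew_shapeD(2)[OF assms] unfolding order_convex_def by blast
  moreover have "hook_length (D\<inverse>) (j, i) = hook_length D (i, j)" for i j
    by (simp add: hook_length_def)
  then have "hooks_bounded k (D\<inverse>)"
    using k_skew_shapeD(3)[OF assms] unfolding hooks_bounded_def by auto
  ultimately show ?thesis
    using assms unfolding k_skew_shape_def by (auto simp: add.commute)
qed

text \<open>The hook of the leftmost cell of a row contains the row.\<close>

lemma row_size_le:
  assumes "k_skew_shape k D"
  shows "row_size D i \<le> k"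
proof (cases "{j. (i, j) \<in> D} = {}")
  case True
  then show ?thesis by (simp add: row_size_def)
next
  case False
  define j where "j = Min {j. (i, j) \<in> D}"
  have fin: "finite {j. (i, j) \<in> D}" using finite_row k_skew_shapeD(1)[OF assms] .
  have j: "(i, j) \<in> D" using Min_in[OF fin False] by (simp add: j_def)
  have "{y. (i, y) \<in> D} = insert j {y. j < y \<and> (i, y) \<in> D}"
    using j Min_le[OF fin] by (auto simp: j_def le_less)
  then have "row_size D i = Suc (card {y. j < y \<and> (i, y) \<in> D})"
    using fin by (simp add: row_size_def)
  then show ?thesis
    using j k_skew_shapeD(3)[OF assms] by (force simp: hooks_bounded_def hook_length_def)
qed

text \<open>
  No row is empty: the cell of row \<open>i\<close> in the first column belongs to \<open>D\<close> or is a cell below \<open>D\<close>,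
  and in the second case the column alone cannot account for more than \<open>k\<close> cells.
\<close>

lemma row_size_pos:
  assumes D: "k_skew_shape k D" and i: "i < num_rows D"
  shows "0 < row_size D i"
proof (cases "(i, 0) \<in> D")
  case True
  then show ?thesis
    using finite_row[OF k_skew_shapeD(1)[OF D]] by (auto simp: row_size_def card_gt_0_iff)
next
  case False
  from i obtain i' j' where "(i', j') \<in> D" "i \<le> i'"
    using less_num_rows_iff[OF k_skew_shapeD(1)[OF D]] by blast
  then show ?thesis
    using k_skew_shape_below[OF D False] row_size_le[OF k_skew_shape_converse[OF D], of 0]
    by fastforce
qed

text \<open>
  If the leftmost cell \<open>(i + 1, j)\<close> of row \<open>i + 1\<close> has a cell of \<open>D\<close> beneath it, then so does all of
  row \<open>i + 1\<close>.  Otherwise \<open>(i, j)\<close> is a cell below \<open>D\<close>, column \<open>j\<close> lies in the hook of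
  \<open>(i + 1, j)\<close>, and comparing the two bounds gives that row \<open>i\<close> is at least as long.
\<close>

lemma row_size_Suc_le:
  assumes D: "k_skew_shape k D"
  shows "row_size D (Suc i) \<le> row_size D i"
proof (cases "{j. (Suc i, j) \<in> D} = {}")
  case True
  then show ?thesis by (simp add: row_size_def)
next
  case False
  define j where "j = Min {j. (Suc i, j) \<in> D}"
  note [simp] = k_skew_shapeD(1)[OF D]
  have fin: "finite {j. (Suc i, j) \<in> D}" by (simp add: finite_row)
  have j: "(Suc i, j) \<in> D" using Min_in[OF fin False] by (simp add: j_def)
  have jmin: "j \<le> y" if "(Suc i, y) \<in> D" for y using Min_le[OF fin] that by (simp add: j_def)
  show ?thesis
  proof (cases "(i, j) \<in> D")
    case True
    then have "{y. (Suc i, y) \<in> D} \<subseteq> {y. (i, y) \<in> D}"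
      using order_convexD[OF k_skew_shapeD(2)[OF D] True] jmin by auto
    then show ?thesis unfolding row_size_def by (intro card_mono) (simp_all add: finite_row)
  next
    case notin: False
    have "{y. (Suc i, y) \<in> D} = insert j {y. j < y \<and> (Suc i, y) \<in> D}"
      using j jmin by (auto simp: le_less)
    then have row: "row_size D (Suc i) = Suc (card {y. j < y \<and> (Suc i, y) \<in> D})"
      using fin by (simp add: row_size_def)
    have "Suc i \<le> x" if "(x, j) \<in> D" for x
      using order_convexD[OF k_skew_shapeD(2)[OF D] that j, of i j] notin by force
    then have "{x. (x, j) \<in> D} = insert (Suc i) {x. Suc i < x \<and> (x, j) \<in> D}"
      using j by (auto simp: le_less)
    then have "row_size (D\<inverse>) j = Suc (card {x. Suc i < x \<and> (x, j) \<in> D})"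
      using finite_column[OF k_skew_shapeD(1)[OF D], of j] by (simp add: row_size_converse)
    moreover have "hook_length D (Suc i, j) \<le> k"
      using j k_skew_shapeD(3)[OF D] by (simp add: hooks_bounded_def)
    moreover have "k < row_size D i + row_size (D\<inverse>) j"
      using k_skew_shape_below[OF D notin j] by simp
    ultimately show ?thesis using row by (simp add: hook_length_def)
  qed
qed

lemma row_size_antimono:
  assumes "k_skew_shape k D" "i \<le> i'"
  shows "row_size D i' \<le> row_size D i"
  by (rule lift_Suc_antimono_le[where f = "row_size D", OF row_size_Suc_le[OF assms(1)] assms(2)])

lemma bounded_partition_row_sizes:
  assumes "k_skew_shape k D"
  shows "bounded_partition k (row_sizes D)"
  using row_size_pos[OF assms] row_size_le[OF assms] row_size_antimono[OF assms]
  by (auto simp: bounded_partition_def partition_list_def row_sizes_def sorted_wrt_iff_nth_less)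

section \<open>Attaching a first column\<close>

lemma add_column_iff [simp]:
  "(i, 0) \<in> add_column a m D \<longleftrightarrow> a \<le> i \<and> i < a + m"
  "(i, Suc j) \<in> add_column a m D \<longleftrightarrow> (i, j) \<in> D"
  by (auto simp: add_column_def)

lemma finite_add_column:
  assumes "finite D"
  shows "finite (add_column a m D)"
proof -
  have "add_column a m D = (\<lambda>i. (i, 0)) ` {a..<a + m} \<union> (\<lambda>(i, j). (i, Suc j)) ` D"
    by (auto simp: add_column_def)
  then show ?thesis using assms by simp
qed

lemma columns_split:
  "{j. P j} = (if P 0 then {0} else {}) \<union> Suc ` {j. P (Suc j)}"
  by (auto simp: image_iff) (metis not0_implies_Suc)+

lemma row_size_add_column:
  assumes "finite D"
  shows "row_size (add_column a m D) i =
    (if a \<le> i \<and> i < a + m then Suc (row_size D i) else row_size D i)"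
  unfolding row_size_def
  by (subst columns_split) (simp add: finite_row[OF assms] card_image)

lemma column_size_add_column:
  "row_size ((add_column a m D)\<inverse>) 0 = m"
  "row_size ((add_column a m D)\<inverse>) (Suc j) = row_size (D\<inverse>) j"
proof -
  have "{i. a \<le> i \<and> i < a + m} = {a..<a + m}" by auto
  then show "row_size ((add_column a m D)\<inverse>) 0 = m" by (simp add: row_size_converse)
qed (simp add: row_size_converse)

lemma hook_length_add_column:
  "hook_length (add_column a m D) (i, Suc j) = hook_length D (i, j)"
proof -
  have "{y. Suc j < y \<and> (i, y) \<in> add_column a m D} = Suc ` {y. j < y \<and> (i, y) \<in> D}"
    by (subst columns_split) simp
  then show ?thesis by (simp add: hook_length_def card_image)
qed

lemma hook_length_add_column_0:
  assumes "a \<le> i" "i < a + m"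
  shows "hook_length (add_column a m D) (i, 0) = a + m - i + row_size D i"
proof -
  have "{y. 0 < y \<and> (i, y) \<in> add_column a m D} = Suc ` {y. (i, y) \<in> D}"
    by (subst columns_split) simp
  moreover have "{x. i < x \<and> (x, 0) \<in> add_column a m D} = {Suc i..<a + m}"
    using assms by auto
  ultimately show ?thesis using assms by (simp add: hook_length_def card_image row_size_def)
qed

lemma row_sizes_converse_add_column:
  assumes fin: "finite D" and m: "0 < m"
  shows "row_sizes ((add_column a m D)\<inverse>) = m # row_sizes (D\<inverse>)"
proof -
  let ?E = "add_column a m D"
  have "n < num_rows (?E\<inverse>) \<longleftrightarrow> n < Suc (num_rows (D\<inverse>))" for n
  proof (cases n)
    case 0
    have "\<exists>j i. (j, i) \<in> ?E\<inverse> \<and> 0 \<le> j" using m by (intro exI[of _ 0] exI[of _ a]) simp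
    then have "0 < num_rows (?E\<inverse>)" using less_num_rows_iff finite_add_column[OF fin] by simp
    then show ?thesis using 0 by simp
  next
    case (Suc j)
    have "(\<exists>j' i. (i, j') \<in> ?E \<and> Suc j \<le> j') \<longleftrightarrow> (\<exists>j' i. (i, j') \<in> D \<and> j \<le> j')"
      by (metis Suc_le_D Suc_le_mono add_column_iff(2))
    then show ?thesis using Suc by (simp add: less_num_rows_iff finite_add_column fin)
  qed
  then have "num_rows (?E\<inverse>) = Suc (num_rows (D\<inverse>))" by (metis linorder_neqE_nat less_irrefl)
  then show ?thesis
    by (simp add: row_sizes_def upt_conv_Cons column_size_add_column map_Suc_upt[symmetric]
        del: upt_Suc)
qed

text \<open>
  The column is attached at the lowest row \<open>a\<close> with at most \<open>k - m\<close> cells.  The rows beneath \<open>a\<close> have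
  more than \<open>k - m\<close> cells, which is the condition on the new cells below the diagram, and the rows
  above \<open>a\<close> are no longer than row \<open>a\<close>, which bounds the new hooks.
\<close>

lemma k_skew_shape_add_column:
  assumes D: "k_skew_shape k D" and m: "m \<le> k" and col: "row_size (D\<inverse>) 0 \<le> m"
  shows "\<exists>a. k_skew_shape k (add_column a m D)"
proof -
  note fin = k_skew_shapeD(1)[OF D]
  have "{j. (num_rows D, j) \<in> D} = {}"
    using less_num_rows_iff[OF fin, of "num_rows D"] by blast
  then have "row_size D (num_rows D) = 0" by (simp add: row_size_def)
  then have ex: "\<exists>i. row_size D i \<le> k - m" by (metis le0)
  define a where "a = (LEAST i. row_size D i \<le> k - m)"
  have rowa: "row_size D a \<le> k - m" unfolding a_def using ex by (rule LeastI_ex)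
  have below_a: "k - m < row_size D i" if "i < a" for i
    using not_less_Least that unfolding a_def by fastforce
  have above_a: "row_size D i \<le> k - m" if "a \<le> i" for i
    using row_size_antimono[OF D that] rowa by simp
  have cols: "row_size (D\<inverse>) j \<le> m" for j
    using row_size_antimono[OF k_skew_shape_converse[OF D], of 0 j] col by simp
  \<comment> \<open>No cell in a row from \<open>a\<close> on is below \<open>D\<close>: its row and column together have at most \<open>k\<close> cells.\<close>
  have inD: "(x, y) \<in> D" if "(i, j) \<in> D" "a \<le> x" "x \<le> i" "y \<le> j" for x y i j
  proof (rule ccontr)
    assume "(x, y) \<notin> D"
    from k_skew_shape_below[OF D this that(1,3,4)] show False
      using above_a[OF that(2)] cols[of y] m by simp
  qed
  \<comment> \<open>Hence a column of \<open>D\<close> that passes row \<open>a\<close> fills all its rows from \<open>a\<close> to its top, and so it ends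
    no higher than the new column.\<close>
  have top: "i < a + m" if "(i, j) \<in> D" for i j
  proof (cases "a \<le> i")
    case True
    have "{a..i} \<subseteq> {x. (x, j) \<in> D}" using inD[OF that] by auto
    then have "card {a..i} \<le> row_size (D\<inverse>) j"
      unfolding row_size_converse by (intro card_mono finite_column[OF fin])
    then show ?thesis using cols[of j] by simp
  next
    case False
    then show ?thesis by simp
  qed
  let ?E = "add_column a m D"
  have conv: "(x, y) \<in> ?E"
    if ij: "(i, j) \<in> ?E" "(i', j') \<in> ?E" and le: "i \<le> x" "x \<le> i'" "j \<le> y" "y \<le> j'"
    for i j i' j' x y
  proof (cases j')
    case 0
    then show ?thesis using that by auto
  next
    case (Suc j1)
    then have ij': "(i', j1) \<in> D" using ij by simp
    show ?thesis
    proof (cases j)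
      case 0
      then have "a \<le> x" using ij le by simp
      then show ?thesis using top[OF ij'] inD[OF ij'] le Suc by (cases y) auto
    next
      case (Suc j0)
      then obtain y0 where "y = Suc y0" using le Suc_le_D by blast
      then show ?thesis
        using order_convexD[OF k_skew_shapeD(2)[OF D] _ ij'] ij le Suc \<open>j' = Suc j1\<close> by auto
    qed
  qed
  have hooks: "hook_length ?E (i, j) \<le> k" if "(i, j) \<in> ?E" for i j
  proof (cases j)
    case 0
    then have i: "a \<le> i" "i < a + m" using that by auto
    then show ?thesis
      using hook_length_add_column_0[OF i] above_a[OF i(1)] m 0 by simp
  next
    case (Suc j0)
    then show ?thesis
      using that k_skew_shapeD(3)[OF D] by (auto simp: hook_length_add_column hooks_bounded_def)
  qed
  have below: "k < row_size ?E i + row_size (?E\<inverse>) j"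
    if ij: "(i, j) \<notin> ?E" "(i', j') \<in> ?E" and le: "i \<le> i'" "j \<le> j'" for i j i' j'
  proof (cases j)
    case 0
    have "i' < a + m" using ij top by (cases j') auto
    then have "i < a" using ij 0 le by auto
    then show ?thesis
      using below_a[of i] m 0 by (simp add: row_size_add_column[OF fin] column_size_add_column)
  next
    case (Suc j0)
    then obtain j1 where "j' = Suc j1" using le Suc_le_D by blast
    then have "k < row_size D i + row_size (D\<inverse>) j0"
      using k_skew_shape_below[OF D, of i j0 i' j1] ij le Suc by simp
    then show ?thesis using Suc by (simp add: row_size_add_column[OF fin] column_size_add_column)
  qed
  have "k_skew_shape k ?E"
    unfolding k_skew_shape_def order_convex_def hooks_bounded_def
    using finite_add_column[OF fin] conv hooks below by fast
  then show ?thesis ..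
qed

text \<open>
  The position of the first column is forced: in a lower position its bottom cell would have row
  and column sizes that sum to more than \<open>k\<close>, and a higher position makes the diagram taller, as
  the first column reaches the top row.
\<close>

lemma k_mult_eq_add_column:
  assumes E: "k_skew_shape k (add_column a m D)" and fin: "finite D" and m: "0 < m"
  shows "k_mult k m D = add_column a m D"
proof -
  let ?E = "add_column a m D"
  let ?P = "\<lambda>F. (\<exists>b. F = add_column b m D) \<and> skew_diagram F \<and> hooks_bounded k F"
  have bottom: "(a, 0) \<in> ?E" using m by simp
  have "i < a + m" if "(i, j) \<in> ?E" for i j
  proof (cases "a \<le> i")
    case True
    then have "(i, 0) \<in> ?E" using order_convexD[OF k_skew_shapeD(2)[OF E] bottom that, of i 0] by simp
    then show ?thesis by simp
  qed simp
  then have height: "num_rows ?E \<le> a + m"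
    using less_num_rows_iff[OF finite_add_column[OF fin], where i = "a + m"]
    by (meson leD leI less_le_trans)
  have P: "?P ?E"
    using order_convex_skew_diagram k_skew_shapeD[OF E] by blast
  have unique: "F = ?E \<or> num_rows ?E < num_rows F" if F: "?P F" for F
  proof -
    from F obtain b where b: "F = add_column b m D" and hooks: "hooks_bounded k F" by blast
    have "(b, 0) \<in> F" using b m by simp
    then have "hook_length F (b, 0) \<le> k" using hooks by (auto simp: hooks_bounded_def)
    then have hook: "m + row_size D b \<le> k"
      using b m hook_length_add_column_0[of b b m D] by simp
    have "a \<le> b"
    proof (rule ccontr)
      assume "\<not> a \<le> b"
      then have "k < row_size ?E b + row_size (?E\<inverse>) 0"
        using k_skew_shape_below[OF E _ bottom, of b 0] by simp
      then show False using hook \<open>\<not> a \<le> b\<close>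
        by (simp add: row_size_add_column[OF fin] column_size_add_column)
    qed
    moreover have "(b + m - 1, 0) \<in> F" using b m by simp
    then have "b + m - 1 < num_rows F"
      using b less_num_rows_iff finite_add_column[OF fin] by blast
    ultimately show ?thesis using height b m by (cases "a = b") auto
  qed
  have "?P (k_mult k m D)" and "num_rows (k_mult k m D) \<le> num_rows ?E"
    using arg_min_nat_lemma[where P = ?P and m = num_rows, OF P] P unfolding k_mult_def by blast+
  then show ?thesis using unique[of "k_mult k m D"] by auto
qed

section \<open>Column sizes and product diagrams\<close>

lemma k_skew_shape_empty: "k_skew_shape k {}"
  by (simp add: k_skew_shape_def order_convex_def hooks_bounded_def)

lemma row_sizes_empty: "row_sizes {} = []"
  by (simp add: row_sizes_def num_rows_def)

text \<open>
  The induction step for rebuilding a diagram from its columns.  The first column is non-empty, as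
  every column of the class is, and by convexity it occupies an interval of rows.
\<close>

lemma k_skew_shape_first_column:
  assumes D: "k_skew_shape k D" and ne: "D \<noteq> {}"
  obtains a m D' where "D = add_column a m D'" "0 < m" "k_skew_shape k D'"
proof -
  note fin = k_skew_shapeD(1)[OF D]
  let ?C = "{i. (i, 0) \<in> D}"
  define a where "a = Min ?C"
  define m where "m = card ?C"
  define D' where "D' = {(i, j). (i, Suc j) \<in> D}"
  have "\<exists>i j. (i, j) \<in> D" using ne by auto
  then have "0 < num_rows (D\<inverse>)" using fin by (auto simp: less_num_rows_iff)
  then have m: "0 < m"
    using row_size_pos[OF k_skew_shape_converse[OF D]] by (simp add: m_def row_size_converse)
  then have finC: "finite ?C" and neC: "?C \<noteq> {}" by (auto simp: m_def card_gt_0_iff)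
  define b where "b = Max ?C"
  have a: "(a, 0) \<in> D" "\<And>x. (x, 0) \<in> D \<Longrightarrow> a \<le> x"
    and b: "(b, 0) \<in> D" "\<And>x. (x, 0) \<in> D \<Longrightarrow> x \<le> b"
    using Min_in[OF finC neC] Max_in[OF finC neC] Min_le[OF finC] Max_ge[OF finC]
    by (simp_all add: a_def b_def)
  have "(x, 0) \<in> D" if "a \<le> x" "x \<le> b" for x
    using order_convexD[OF k_skew_shapeD(2)[OF D] a(1) b(1) that] by simp
  then have "(x, 0) \<in> D \<longleftrightarrow> a \<le> x \<and> x \<le> b" for x using a(2) b(2) by blast
  then have Cab: "?C = {a..b}" by (simp add: atLeastAtMost_def atLeast_def atMost_def Collect_conj_eq)
  have "m = Suc b - a" unfolding m_def Cab by simp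
  then have C: "?C = {a..<a + m}" unfolding Cab using m by auto
  have D_eq: "D = add_column a m D'"
  proof -
    have "(i, j) \<in> D \<longleftrightarrow> (i, j) \<in> add_column a m D'" for i j
      using C by (cases j) (auto simp: D'_def)
    then show ?thesis by auto
  qed
  have "D' = (\<lambda>(i, j). (i, Suc j)) -` D" by (auto simp: D'_def)
  then have fin': "finite D'" using fin by (simp add: finite_vimageI inj_on_def)
  have conv: "order_convex D'"
    unfolding order_convex_def
  proof (intro allI impI)
    fix i j i' j' x y
    assume "(i, j) \<in> D'" "(i', j') \<in> D'" "i \<le> x" "x \<le> i'" "j \<le> y" "y \<le> j'"
    then show "(x, y) \<in> D'"
      using order_convexD[OF k_skew_shapeD(2)[OF D], of i "Suc j" i' "Suc j'" x "Suc y"]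
      by (simp add: D'_def)
  qed
  have "hook_length D' (i, j) \<le> k" if "(i, j) \<in> D'" for i j
  proof -
    have "(i, Suc j) \<in> D" using that by (simp add: D'_def)
    then have "hook_length D (i, Suc j) \<le> k"
      using k_skew_shapeD(3)[OF D] unfolding hooks_bounded_def by blast
    then show ?thesis by (simp add: D_eq hook_length_add_column)
  qed
  then have hooks: "hooks_bounded k D'" by (auto simp: hooks_bounded_def)
  have below: "k < row_size D' i + row_size (D'\<inverse>) j"
    if "(i, j) \<notin> D'" "(i', j') \<in> D'" "i \<le> i'" "j \<le> j'" for i j i' j'
  proof -
    have in': "(i, Suc j) \<notin> D" "(i', Suc j') \<in> D" using that by (auto simp: D'_def)
    \<comment> \<open>A row that meets a cell below \<open>D'\<close> misses the removed column, so it keeps its size.\<close>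
    have "(i, 0) \<notin> D"
      using order_convexD[OF k_skew_shapeD(2)[OF D] _ in'(2), of i 0 i "Suc j"] in' that by auto
    then have "row_size D i = row_size D' i"
      by (simp add: D_eq row_size_add_column[OF fin'])
    moreover have "row_size (D\<inverse>) (Suc j) = row_size (D'\<inverse>) j"
      by (simp add: D_eq column_size_add_column)
    ultimately show ?thesis
      using k_skew_shape_below[OF D in' that(3)] that(4) by simp
  qed
  have "k_skew_shape k D'"
    unfolding k_skew_shape_def using fin' conv hooks below by blast
  then show ?thesis using that D_eq m by blast
qed

lemma k_diagram_column_sizes:
  assumes "k_skew_shape k D"
  shows "k_diagram k (row_sizes (D\<inverse>)) = D"
  using assms
proof (induction "length (row_sizes (D\<inverse>))" arbitrary: D rule: less_induct)
  case less
  show ?case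
  proof (cases "D = {}")
    case True
    then show ?thesis by (simp add: row_sizes_empty k_diagram_def)
  next
    case False
    then obtain a m D' where D': "D = add_column a m D'" "0 < m" "k_skew_shape k D'"
      using k_skew_shape_first_column less.prems by blast
    note fin' = k_skew_shapeD(1)[OF D'(3)]
    have sizes: "row_sizes (D\<inverse>) = m # row_sizes (D'\<inverse>)"
      using row_sizes_converse_add_column[OF fin' D'(2)] D'(1) by simp
    then have "k_diagram k (row_sizes (D'\<inverse>)) = D'" using less.hyps D'(3) by simp
    then have "k_diagram k (row_sizes (D\<inverse>)) = k_mult k m D'" by (simp add: sizes k_diagram_def)
    also have "\<dots> = D" using k_mult_eq_add_column[OF _ fin' D'(2)] less.prems D'(1) by simp
    finally show ?thesis .
  qed
qed

lemma ex_k_skew_shape: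
  assumes "bounded_partition k p"
  shows "\<exists>D. k_skew_shape k D \<and> row_sizes (D\<inverse>) = p"
  using assms
proof (induction p)
  case Nil
  have "k_skew_shape k {} \<and> row_sizes ({}\<inverse>) = []"
    by (simp add: k_skew_shape_empty row_sizes_empty)
  then show ?case ..
next
  case (Cons m p)
  then have m: "0 < m" "m \<le> k" and le: "\<forall>x \<in> set p. x \<le> m" and p: "bounded_partition k p"
    by (auto simp: bounded_partition_def partition_list_def)
  obtain D where D: "k_skew_shape k D" "row_sizes (D\<inverse>) = p" using Cons.IH[OF p] by blast
  have "row_size (D\<inverse>) 0 \<le> m"
  proof (cases "0 < num_rows (D\<inverse>)")
    case True
    then have "row_size (D\<inverse>) 0 \<in> set p" using D(2) by (force simp: row_sizes_def)
    then show ?thesis using le by blast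
  next
    case False
    then have "D = {}"
      using less_num_rows_iff[of "D\<inverse>" 0] k_skew_shapeD(1)[OF D(1)] by auto
    then show ?thesis by (simp add: row_size_def)
  qed
  then obtain a where "k_skew_shape k (add_column a m D)"
    using k_skew_shape_add_column[OF D(1) m(2)] by blast
  then show ?case
    using row_sizes_converse_add_column[OF k_skew_shapeD(1)[OF D(1)] m(1)] D(2) by blast
qed

theorem theorem35:
  fixes k :: nat and p :: "nat list"
  assumes "1 \<le> k" and "bounded_partition k p"
  shows "bounded_partition k (k_conjugate k p) \<and> k_conjugate k (k_conjugate k p) = p"
proof -
  obtain D where D: "k_skew_shape k D" "row_sizes (D\<inverse>) = p"
    using ex_k_skew_shape[OF assms(2)] by blast
  have conj: "k_conjugate k p = row_sizes D"
    using k_diagram_column_sizes[OF D(1)] D(2) by (simp add: k_conjugate_eq_row_sizes)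
  have "k_diagram k (row_sizes D) = D\<inverse>"
    using k_diagram_column_sizes[OF k_skew_shape_converse[OF D(1)]] by simp
  then have "k_conjugate k (k_conjugate k p) = p"
    using conj D(2) by (simp add: k_conjugate_eq_row_sizes)
  then show ?thesis using bounded_partition_row_sizes[OF D(1)] conj by simp
qed

end
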